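(* Let $I$ be a nondegenerate compact interval contained in $(0,\infty)$, and let $(\xi_n)_{n\in\mathbb{N}}$ be a sequence of independent and identically distributed (real-valued) random variables on a probability space $(\Omega,\mathcal{A},\mathbb{P})$ such that $\mathbb{P}(\xi_1\in[0,1])=1$. For each $n\in\mathbb{N}$, let $M_n:\Omega\to\mathcal{M}_2$, $$(M_n(\omega))(x_1,x_2):=x_1^{\xi_n(\omega)}x_2^{1-\xi_n(\omega)},\qquad x_1,x_2\in I,$$ for all $\omega\in\Omega$ with $\xi_n(\omega)\in[0,1]$, and $M_n(\omega):=m^*$ for all other $\omega\in\Omega$ (a $\mathbb{P}$-null event), where $m^*\in\mathcal{M}_2$ is a fixed, arbitrary mean. Then for each $n\in\mathbb{N}$, $M_n$ is a random mean generated by $\xi_n$, and $$\mathbb{P}\left(\left\{\omega\in\Omega:\lim_{n\to\infty}\sup_{x_1,x_2\in I}\frac{\left(\prod_{j=1}^n(M_j(\omega))(x_1,x_2)\right)^{\frac1n}}{x_1^{\mathbb{E}(\xi_1)}x_2^{1-\mathbb{E}(\xi_1)}}=1\right\}\right)=1.$$ Further, as $n\to\infty$, $$\left(\sup_{x_1,x_2\in I}\frac{\left(\prod_{j=1}^n(M_j(\cdot))(x_1,x_2)\right)^{\frac1n}}{x_1^{\mathbb{E}(\xi_1)}x_2^{1-\mathbb{E}(\xi_1)}}\right)^{\sqrt n}\ \stackrel{\mathcal{D}}{\longrightarrow}\ \left(\frac{\max(I)}{\min(I)}\right)^{\left|\mathcal{N}\left(0,\mathbb{D}^2(\xi_1)\right)\right|},$$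 where for $j\in\mathbb{N}$ and $x_1,x_2\in I$, $(M_j(\cdot))(x_1,x_2)$ denotes the random variable $\Omega\ni\omega\mapsto(M_j(\omega))(x_1,x_2)$, $\max(I):=\max\{x:x\in I\}$ and $\min(I):=\min\{x:x\in I\}$.
   Context: $\mathbb{N}$ is the set of positive integers. A nondegenerate interval is one containing at least two distinct points. $\mathcal{B}(\cdot)$ denotes the Borel $\sigma$-algebra. $\mathcal{C}(I^p)$ is the Banach space of real-valued continuous functions on $I^p$ with the supremum norm. $\mathbb{D}^2(\xi_1)$ is the variance of $\xi_1$, $\stackrel{\mathcal{D}}{\longrightarrow}$ denotes convergence in distribution, and $\mathcal{N}(0,\sigma^2)$ in the limit denotes a random variable with the normal distribution of mean $0$ and variance $\sigma^2$, where $\mathcal{N}(0,0)$ is the Dirac distribution concentrated at $0$. $\mathcal{M}_p\subset\mathcal{C}(I^p)$ is the set of $p$-variable (continuous) means on $I$: those $m\in\mathcal{C}(I^p)$ with $\min(x)\le m(x)\le\max(x)$ for all $x\in I^p$, where $\min(x)$ and $\max(x)$ are the minimum and maximum of the coordinates of $x$. Here $p=2$. Definition (random mean generated by $\xi$). Let $\xi:\Omega\to\mathbb{R}^d$ be a random variable on $(\Omega,\mathcal{A},\mathbb{P})$. A map $M:\Omega\to\mathcal{M}_p$ is called a ($p$-variable, continuous) random mean (in $I$) generated by $\xi$ if: (i) $M$ is $(\mathcal{A},\mathcal{B}(\mathcal{C}(I^p)))$-measurable; and (ii) there is a $(\mathcal{B}(I^p)\times\mathcal{B}(\mathbb{R}^d),\mathcal{B}(I))$-measurable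 map $M_\xi:I^p\times\mathbb{R}^d\to I$ such that (a) for every $\omega\in\Omega$ the map $I^p\ni x\mapsto M_\xi(x,\xi(\omega))$ is in $\mathcal{C}(I^p)$, and (b) $\mathbb{P}(\{\omega\in\Omega:(M(\omega))(x)=M_\xi(x,\xi(\omega))\text{ for every }x\in I^p\})=1$. *)

theory Defs
  imports "HOL-Analysis.Urysohn" "HOL-Probability.Probability"
begin

definition cube :: "real set \<Rightarrow> (real^'p) set" where
  "cube I = {x. \<forall>i. x $ i \<in> I}"

text \<open>The space of continuous functions on \<open>I\<^sup>p\<close> with the supremum metric. Its elements are
  functions on the whole type that are extensional, i.e. \<open>undefined\<close> outside \<open>cube I\<close>.\<close>

definition contfun :: "real set \<Rightarrow> (real^'p \<Rightarrow> real) metric" where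
  "contfun I = cfunspace (top_of_set (cube I)) euclidean_metric"

definition borel_contfun :: "real set \<Rightarrow> (real^'p \<Rightarrow> real) measure" where
  "borel_contfun I = sigma (mspace (contfun I)) {U. openin (mtopology_of (contfun I)) U}"

definition means :: "real set \<Rightarrow> (real^'p \<Rightarrow> real) set" where
  "means I = {m \<in> mspace (contfun I). \<forall>x\<in>cube I.
     Min (range (\<lambda>i. x $ i)) \<le> m x \<and> m x \<le> Max (range (\<lambda>i. x $ i))}"

definition random_mean ::
  "'a measure \<Rightarrow> real set \<Rightarrow> ('a \<Rightarrow> 'd::euclidean_space) \<Rightarrow> ('a \<Rightarrow> real^'p \<Rightarrow> real) \<Rightarrow> bool" where
  "random_mean P I \<xi> M \<longleftrightarrow>
     \<xi> \<in> P \<rightarrow>\<^sub>M borel \<and>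
     M \<in> space P \<rightarrow> means I \<and>
     M \<in> P \<rightarrow>\<^sub>M borel_contfun I \<and>
     (\<exists>M\<^sub>\<xi> \<in> (restrict_space borel (cube I) \<Otimes>\<^sub>M borel) \<rightarrow>\<^sub>M restrict_space borel I.
        (\<forall>\<omega>\<in>space P. (\<lambda>x\<in>cube I. M\<^sub>\<xi> (x, \<xi> \<omega>)) \<in> mspace (contfun I)) \<and>
        measure P {\<omega> \<in> space P. \<forall>x\<in>cube I. M \<omega> x = M\<^sub>\<xi> (x, \<xi> \<omega>)} = 1)"

definition normal_distribution :: "real \<Rightarrow> real \<Rightarrow> real measure" where
  "normal_distribution \<mu> v =
     (if v = 0 then return borel \<mu> else density lborel (\<lambda>x. ennreal (normal_density \<mu> (sqrt v) x)))"

text \<open>Here \<open>x $ 1\<close> and \<open>x $ 2\<close> are the two arguments, and \<open>e\<close> stands for the expectation.\<close>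

definition sup_ratio ::
  "real set \<Rightarrow> (nat \<Rightarrow> 'a \<Rightarrow> real^2 \<Rightarrow> real) \<Rightarrow> real \<Rightarrow> nat \<Rightarrow> 'a \<Rightarrow> real" where
  "sup_ratio I M e n \<omega> =
     (SUP x\<in>cube I. (\<Prod>j=1..n. M j \<omega> x) powr (1 / real n) / (x $ 1 powr e * x $ 2 powr (1 - e)))"

end

theory Submission
  imports Defs
begin

text \<open>For \<open>I = [a, b]\<close> and all \<open>\<xi>\<^sub>j\<close> in \<open>[0, 1]\<close>, the ratio inside the supremum is
  \<open>(x\<^sub>1 / x\<^sub>2)\<close> raised to the power \<open>S\<^sub>n / n - e\<close>, where \<open>S\<^sub>n\<close> is the \<open>n\<close>-th partial sum of the
  \<open>\<xi>\<^sub>j\<close> and \<open>e\<close> their expectation. Its supremum is attained at a corner of the square and equals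
  \<open>b / a\<close> raised to the power \<open>\<bar>S\<^sub>n / n - e\<bar>\<close>. The strong law of large numbers gives the first limit.
  The \<open>sqrt n\<close>-th power of the supremum is a continuous function of \<open>(S\<^sub>n - n e) / sqrt n\<close>, so the
  central limit theorem gives the second one. For bounded variables the strong law follows from
  Hoeffding's inequality and the Borel--Cantelli lemma.\<close>

section \<open>Measurability of suprema over compact sets\<close>

text \<open>By continuity, a bound \<open>c\<close> on a countable dense subset \<open>D\<close> is
  a bound on all of \<open>K\<close>, so the event that the supremum is at most \<open>c\<close> is
  a countable intersection of measurable events. Compactness makes the values bounded above, so that
  \<open>SUP\<close> is a genuine least upper bound.\<close>

lemma borel_measurable_SUP_continuous:
  fixes f :: "'a \<Rightarrow> 'b::{metric_space, second_countable_topology} \<Rightarrow> real"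
  assumes K: "compact K" "K \<noteq> {}"
    and cont: "\<And>\<omega>. \<omega> \<in> space M \<Longrightarrow> continuous_on K (f \<omega>)"
    and meas: "\<And>x. x \<in> K \<Longrightarrow> (\<lambda>\<omega>. f \<omega> x) \<in> borel_measurable M"
  shows "(\<lambda>\<omega>. SUP x\<in>K. f \<omega> x) \<in> borel_measurable M"
proof (rule borel_measurableI_le)
  fix c :: real
  obtain D where D: "countable D" "D \<subseteq> K" "K \<subseteq> closure D"
    using separable[of K] by blast
  have clD: "closure D = K"
    using D closure_minimal[OF D(2) compact_imp_closed[OF K(1)]] by blast
  have "(SUP x\<in>K. f \<omega> x) \<le> c \<longleftrightarrow> (\<forall>x\<in>D. f \<omega> x \<le> c)" if \<omega>: "\<omega> \<in> space M" for \<omega>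
  proof -
    have "bdd_above (f \<omega> ` K)"
      by (intro bounded_imp_bdd_above compact_imp_bounded compact_continuous_image cont \<omega> K)
    then have "(SUP x\<in>K. f \<omega> x) \<le> c \<longleftrightarrow> (\<forall>x\<in>K. f \<omega> x \<le> c)"
      by (intro cSUP_le_iff K)
    also have "\<dots> \<longleftrightarrow> (\<forall>x\<in>D. f \<omega> x \<le> c)"
      using continuous_le_on_closure[of D "f \<omega>"] cont[OF \<omega>] D(2) clD by blast
    finally show ?thesis .
  qed
  then have "{\<omega> \<in> space M. (SUP x\<in>K. f \<omega> x) \<le> c} = {\<omega> \<in> space M. \<forall>x\<in>D. f \<omega> x \<le> c}"
    by blast
  also have "\<dots> \<in> sets M"
    by (intro sets.sets_Collect_countable_All' D(1) borel_measurable_le meas) (use D(2) in auto)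
  finally show "{\<omega> \<in> space M. (SUP x\<in>K. f \<omega> x) \<le> c} \<in> sets M" .
qed

section \<open>Weak convergence and the central limit theorem\<close>

text \<open>Needed because the laws in the theorem are identified with normalized sums only from
  \<open>n = 1\<close> on.\<close>

lemma weak_conv_m_eventually_cong:
  assumes "weak_conv_m \<mu> \<nu>" "\<forall>\<^sub>F n in sequentially. \<mu> n = \<mu>' n"
  shows "weak_conv_m \<mu>' \<nu>"
  unfolding weak_conv_m_def weak_conv_def
proof (intro allI impI)
  fix x assume "isCont (cdf \<nu>) x"
  with assms(1) have "(\<lambda>n. cdf (\<mu> n) x) \<longlonglongrightarrow> cdf \<nu> x"
    by (simp add: weak_conv_m_def weak_conv_def)
  then show "(\<lambda>n. cdf (\<mu>' n) x) \<longlonglongrightarrow> cdf \<nu> x"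
    by (rule Lim_transform_eventually) (use assms(2) in \<open>auto elim: eventually_mono\<close>)
qed

text \<open>This is the continuous mapping theorem: weak convergence is tested on bounded continuous
  functions, and composing such a function with \<open>g\<close> gives another one.\<close>

lemma weak_conv_m_distr_continuous:
  fixes g :: "real \<Rightarrow> real"
  assumes distr: "\<And>n. real_distribution (\<mu> n)" "real_distribution \<nu>"
    and conv: "weak_conv_m \<mu> \<nu>"
    and g: "continuous_on UNIV g"
  shows "weak_conv_m (\<lambda>n. distr (\<mu> n) borel g) (distr \<nu> borel g)"
proof -
  have [measurable]: "g \<in> borel_measurable borel"
    by (rule borel_measurable_continuous_onI[OF g])
  have sets [measurable_cong]: "sets (\<mu> n) = sets borel" "sets \<nu> = sets borel" for n
    using distr by (auto simp: real_distribution_def real_distribution_axioms_def)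
  have prob: "prob_space (\<mu> n)" "prob_space \<nu>" for n
    using distr by (auto simp: real_distribution_def)
  show ?thesis
  proof (rule integral_bdd_continuous_conv_imp_weak_conv)
    show "real_distribution (distr (\<mu> n) borel g)" "real_distribution (distr \<nu> borel g)" for n
      by (intro prob_space.real_distribution_distr prob; simp)+
  next
    fix f :: "real \<Rightarrow> real"
    assume f: "\<And>x. isCont f x" "\<And>x. \<bar>f x\<bar> \<le> 1"
    have [measurable]: "f \<in> borel_measurable borel"
      using f(1) by (intro borel_measurable_continuous_onI) (simp add: continuous_on_eq_continuous_at)
    have "isCont (\<lambda>x. f (g x)) x" for x
      using g isCont_o2[OF _ f(1)] by (auto simp: continuous_on_eq_continuous_at)
    then have "(\<lambda>n. \<integral>x. f (g x) \<partial>\<mu> n) \<longlonglongrightarrow> (\<integral>x. f (g x) \<partial>\<nu>)"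
      by (intro weak_conv_imp_integral_bdd_continuous_conv[OF distr conv, where B = 1]) (use f(2) in auto)
    then show "(\<lambda>n. integral\<^sup>L (distr (\<mu> n) borel g) f) \<longlonglongrightarrow> integral\<^sup>L (distr \<nu> borel g) f"
      by (simp add: integral_distr)
  qed
qed

lemma real_distribution_normal_distribution:
  assumes "0 \<le> v"
  shows "real_distribution (normal_distribution \<mu> v)"
proof (cases "v = 0")
  case True
  then show ?thesis
    by (auto simp: normal_distribution_def real_distribution_def real_distribution_axioms_def
        intro!: prob_space_return)
next
  case False
  with assms have "prob_space (density lborel (\<lambda>x. ennreal (normal_density \<mu> (sqrt v) x)))"
    by (intro prob_space_normal_density) auto
  with False show ?thesis
    by (auto simp: normal_distribution_def real_distribution_def real_distribution_axioms_def)
qed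

lemma distr_std_normal_distribution_scale:
  assumes "0 < v"
  shows "distr std_normal_distribution borel (\<lambda>x. sqrt v * x) = normal_distribution 0 v"
proof -
  interpret N: prob_space std_normal_distribution
    by (rule prob_space_normal_density) simp
  \<comment> \<open>The identity is viewed as a standard normal variable, so that the affine rule
    for normal variables applies to it.\<close>
  have "distributed std_normal_distribution lborel (\<lambda>x. x) std_normal_density"
    by (simp add: distributed_def distr_id2)
  from N.normal_density_affine[OF this, of "sqrt v" 0] assms
  have "distr std_normal_distribution lborel (\<lambda>x. sqrt v * x) = normal_distribution 0 v"
    by (simp add: distributed_def normal_distribution_def)
  then show ?thesis
    by (simp cong: distr_cong)
qed

lemma (in prob_space) AE_eq_expectation_of_variance_eq_0:
  fixes X :: "'a \<Rightarrow> real"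
  assumes [measurable]: "random_variable borel X"
    and sq: "integrable M (\<lambda>x. (X x)\<^sup>2)" and "variance X = 0"
  shows "AE x in M. X x = expectation X"
proof -
  have int: "integrable M X"
    by (rule square_integrable_imp_integrable[OF _ sq]) simp
  have "integrable M (\<lambda>x. (X x - expectation X)\<^sup>2)"
    using int sq by (auto simp: power2_diff)
  then have "AE x in M. (X x - expectation X)\<^sup>2 = 0"
    using integral_nonneg_eq_0_iff_AE[of M "\<lambda>x. (X x - expectation X)\<^sup>2"] assms(3) by simp
  then show ?thesis by simp
qed

text \<open>For positive variance, the standardized theorem is multiplied through by
  \<open>sqrt v\<close>, using continuous mapping. For zero variance, all variables are almost
  surely constant, and every normalized sum has the Dirac law at 0.\<close>

lemma (in prob_space) central_limit_theorem_normal_distribution: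
  fixes X :: "nat \<Rightarrow> 'a \<Rightarrow> real"
  assumes indep: "indep_vars (\<lambda>_. borel) X UNIV"
    and iid: "\<And>n. distr M borel (X n) = distr M borel (X 0)"
    and sq: "integrable M (\<lambda>x. (X 0 x)\<^sup>2)"
  shows "weak_conv_m (\<lambda>n. distr M borel (\<lambda>x. (\<Sum>i<n. X i x - expectation (X 0)) / sqrt (real n)))
    (normal_distribution 0 (variance (X 0)))"
proof -
  define m where "m = expectation (X 0)"
  define v where "v = variance (X 0)"
  have [measurable]: "random_variable borel (X n)" for n
    using indep unfolding indep_vars_def2 by simp
  \<comment> \<open>Moments depend on the law alone, so those of \<open>X 0\<close> are shared by
    all \<open>X n\<close>.\<close>
  have transfer: "expectation (\<lambda>x. f (X n x)) = expectation (\<lambda>x. f (X 0 x))"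
    if "f \<in> borel_measurable borel" for f :: "real \<Rightarrow> real" and n
    using that integral_distr[of "X n" M borel f] integral_distr[of "X 0" M borel f] iid[of n] by simp
  have sq': "integrable M (\<lambda>x. (X n x)\<^sup>2)" for n
    using sq integrable_distr_eq[of "X n" M borel "\<lambda>x. x\<^sup>2"] integrable_distr_eq[of "X 0" M borel "\<lambda>x. x\<^sup>2"] iid[of n]
    by simp
  have mean: "expectation (X n) = m" for n
    using transfer[of "\<lambda>x. x" n] by (simp add: m_def)
  have var: "variance (X n) = v" for n
    using transfer[of "\<lambda>x. (x - m)\<^sup>2" n] by (simp add: mean v_def flip: m_def)
  have "weak_conv_m (\<lambda>n. distr M borel (\<lambda>x. (\<Sum>i<n. X i x - m) / sqrt (real n))) (normal_distribution 0 v)"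
  proof (cases "v = 0")
    case True
    have "AE x in M. X n x = m" for n
      using AE_eq_expectation_of_variance_eq_0[OF _ sq'[of n]] var[of n] True by (simp add: mean)
    then have AE: "AE x in M. \<forall>n. X n x = m"
      by (simp add: AE_all_countable)
    have "distr M borel (\<lambda>x. (\<Sum>i<n. X i x - m) / sqrt (real n)) = distr M borel (\<lambda>_. 0)" for n
      by (rule distr_cong_AE) (use AE in auto)
    moreover have "distr M borel (\<lambda>_. 0::real) = normal_distribution 0 v"
      using True by (simp add: normal_distribution_def distr_const)
    ultimately show ?thesis
      by (simp add: weak_conv_m_def weak_conv_def)
  next
    case False
    moreover have "0 \<le> v"
      unfolding v_def by simp
    ultimately have v: "0 < v"
      by simp
    have "weak_conv_m (\<lambda>n. distr M borel (\<lambda>x. (\<Sum>i<n. X i x - m) / sqrt (real n * (sqrt v)\<^sup>2))) std_normal_distribution"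
      by (rule central_limit_theorem[OF indep mean _ sq' _ iid]) (use v var in simp_all)
    then have "weak_conv_m (\<lambda>n. distr (distr M borel (\<lambda>x. (\<Sum>i<n. X i x - m) / sqrt (real n * v))) borel (\<lambda>x. sqrt v * x))
        (distr std_normal_distribution borel (\<lambda>x. sqrt v * x))"
      using v by (intro weak_conv_m_distr_continuous)
        (auto intro!: real_distribution_distr real_dist_normal_dist continuous_intros)
    moreover have "distr (distr M borel (\<lambda>x. (\<Sum>i<n. X i x - m) / sqrt (real n * v))) borel (\<lambda>x. sqrt v * x)
        = distr M borel (\<lambda>x. (\<Sum>i<n. X i x - m) / sqrt (real n))" for n
    proof -
      have "sqrt v * (y / sqrt (real n * v)) = y / sqrt (real n)" for y
        using v by (simp add: real_sqrt_mult)
      then show ?thesis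
        by (simp add: distr_distr comp_def)
    qed
    ultimately show ?thesis
      using distr_std_normal_distribution_scale[OF v] by simp
  qed
  then show ?thesis
    unfolding v_def m_def .
qed

section \<open>The strong law for bounded variables\<close>

lemma (in prob_space) strong_law_of_large_numbers_bounded:
  fixes X :: "nat \<Rightarrow> 'a \<Rightarrow> real"
  assumes indep: "indep_vars (\<lambda>_. borel) X UNIV"
    and iid: "\<And>n. distr M borel (X n) = distr M borel (X 0)"
    and bounded: "AE x in M. X 0 x \<in> {a..b}" and "a < b"
  shows "AE x in M. (\<lambda>n. (\<Sum>i<n. X i x) / real n) \<longlonglongrightarrow> expectation (X 0)"
proof -
  let ?m = "expectation (X 0)"
  have [measurable]: "random_variable borel (X n)" for n
    using indep unfolding indep_vars_def2 by simp
  have ev: "AE x in M. \<forall>\<^sub>F n in sequentially. \<bar>(\<Sum>i<n. X i x) / real n - ?m\<bar> < \<epsilon>" if "0 < \<epsilon>" for \<epsilon>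
  proof -
    define A where "A n = {x \<in> space M. \<bar>(\<Sum>i<n. X i x) / real n - ?m\<bar> \<ge> \<epsilon>}" for n
    \<comment> \<open>Hoeffding's bound is exponential in \<open>n\<close>; with this
      \<open>q\<close> it reads \<open>2 * q ^ n\<close>, a term of a convergent geometric
      series.\<close>
    define q where "q = exp (- 2 * \<epsilon>\<^sup>2 / (b - a)\<^sup>2)"
    have [measurable]: "A n \<in> sets M" for n
      unfolding A_def by measurable
    \<comment> \<open>Hoeffding's inequality is applied to a nonempty index set, hence
      \<open>1 \<le> n\<close>; for summability the first term is irrelevant.\<close>
    have le: "prob (A n) \<le> 2 * q ^ n" if "1 \<le> n" for n
    proof -
      interpret Hoeffding_ineq_iid M "{..<n}" X "X 0" a b ?m
        by unfold_locales (use indep bounded iid in \<open>auto intro: indep_vars_subset\<close>)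
      have "{..<n} \<noteq> {}"
        using that by (auto simp: lessThan_empty_iff)
      from Hoeffding_ineq_abs_ge'[OF less_imp_le[OF \<open>0 < \<epsilon>\<close>] \<open>a < b\<close> this]
      show ?thesis
        by (simp add: A_def q_def exp_of_nat_mult[symmetric] mult_ac)
    qed
    have "0 < (b - a)\<^sup>2"
      using \<open>a < b\<close> by simp
    then have "q < 1"
      using \<open>0 < \<epsilon>\<close> unfolding q_def by simp
    then have "summable (\<lambda>n. 2 * q ^ n)"
      by (intro summable_mult summable_geometric) (simp add: q_def)
    then have "summable (\<lambda>n. prob (A n))"
      by (rule summable_comparison_test'[where N = 1]) (use le in simp)
    then have "AE x in M. \<forall>\<^sub>F n in sequentially. x \<in> space M - A n"
      by (intro borel_cantelli_AE1) (auto simp: less_top[symmetric])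
    then show ?thesis
      by (rule AE_mp) (auto simp: A_def not_le elim!: eventually_mono)
  qed
  \<comment> \<open>The exceptional null set in \<open>ev\<close> depends on \<epsilon>. Restricting
    to the countably many levels \<open>1 / real (Suc k)\<close> leaves a single null set.\<close>
  have "AE x in M. \<forall>k. \<forall>\<^sub>F n in sequentially. \<bar>(\<Sum>i<n. X i x) / real n - ?m\<bar> < 1 / real (Suc k)"
    by (simp only: AE_all_countable) (intro allI ev, simp)
  then show ?thesis
  proof (rule AE_mp, intro AE_I2 impI tendstoI)
    fix x and e :: real
    assume *: "\<forall>k. \<forall>\<^sub>F n in sequentially. \<bar>(\<Sum>i<n. X i x) / real n - ?m\<bar> < 1 / real (Suc k)" and "0 < e"
    obtain k where k: "1 / real (Suc k) < e"
      using nat_approx_posE[OF \<open>0 < e\<close>] by blast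
    from *[rule_format, of k] show "\<forall>\<^sub>F n in sequentially. dist ((\<Sum>i<n. X i x) / real n) ?m < e"
      by (rule eventually_mono) (use k in \<open>simp add: dist_real_def\<close>)
  qed
qed

section \<open>Independence under reindexing\<close>

text \<open>Used with \<open>Suc\<close> to move a family indexed from 1 to the index set
  \<open>UNIV\<close> of the limit theorems.\<close>

lemma (in prob_space) indep_vars_reindex:
  assumes "inj_on f J" "indep_vars M' X (f ` J)"
  shows "indep_vars (M' \<circ> f) (X \<circ> f) J"
  using assms unfolding indep_vars_def2
proof (safe, goal_cases)
  case 2
  let ?F = "\<lambda>i. {X i -` A \<inter> space M |A. A \<in> sets (M' i)}"
  have "indep_sets (\<lambda>j. ?F (f j)) J"
  proof (rule indep_setsI)
    show "?F (f j) \<subseteq> events" if "j \<in> J" for j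
      using 2(3) that unfolding indep_sets_def by blast
  next
    fix A K
    assume K: "K \<noteq> {}" "K \<subseteq> J" "finite K" and A: "\<forall>j\<in>K. A j \<in> ?F (f j)"
    have inj: "inj_on f K"
      using \<open>inj_on f J\<close> K inj_on_subset by blast
    \<comment> \<open>\<open>?B\<close> carries the chosen events over to the image of
      \<open>K\<close>. Injectivity makes this relabelling well defined and turns the product over
      the image back into one over \<open>K\<close>.\<close>
    let ?B = "A \<circ> the_inv_into K f"
    have B: "?B (f j) = A j" if "j \<in> K" for j
      using the_inv_into_f_f[OF inj that] by simp
    have "prob (\<Inter>i\<in>f ` K. ?B i) = (\<Prod>i\<in>f ` K. prob (?B i))"
      by (rule indep_setsD[OF 2(3)]) (use K A B in auto)
    then show "prob (\<Inter>j\<in>K. A j) = (\<Prod>j\<in>K. prob (A j))"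
      using B by (simp add: prod.reindex[OF inj])
  qed
  then show ?case by simp
qed auto

section \<open>Continuous curves in the space of continuous functions\<close>

text \<open>For \<open>s\<close> near \<open>t\<close>, joint continuity and compactness of
  \<open>K\<close> make \<open>h (s, x)\<close> close to \<open>h (t, x)\<close> uniformly in
  \<open>x\<close>, which is closeness in the supremum metric.\<close>

lemma continuous_map_cfunspace:
  fixes h :: "'a::topological_space \<times> 'b::topological_space \<Rightarrow> 'c::metric_space"
  assumes K: "compact K" and h: "continuous_on (UNIV \<times> K) h"
  shows "continuous_map euclidean (mtopology_of (cfunspace (top_of_set K) euclidean_metric))
    (\<lambda>t. \<lambda>x\<in>K. h (t, x))"
proof -
  let ?F = "cfunspace (top_of_set K) (euclidean_metric :: 'c metric)"
  interpret F: Metric_space "mspace ?F" "mdist ?F"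
    by (rule Metric_space_mspace_mdist)
  have in_F: "(\<lambda>x\<in>K. h (t, x)) \<in> mspace ?F" for t
  proof -
    have "continuous_on K (\<lambda>x. h (t, x))"
      by (rule continuous_on_compose2[OF h]) (auto intro!: continuous_intros)
    then have "continuous_on K (\<lambda>x\<in>K. h (t, x))"
      by simp
    then show ?thesis
      using K by (subst compactin_mspace_cfunspace) (auto simp: compactin_subtopology)
  qed
  have "\<exists>U. open U \<and> t \<in> U \<and> (\<forall>s\<in>U. (\<lambda>x\<in>K. h (s, x)) \<in> F.mball (\<lambda>x\<in>K. h (t, x)) e)" if "0 < e" for t e
  proof -
    \<comment> \<open>The supremum of pointwise bounds is only bounded weakly; halving
      \<open>e\<close> secures the strict inequality of the open ball.\<close>
    from \<open>0 < e\<close> have "0 < e / 2" by simp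
    from continuous_on_prod_compactE[OF h K UNIV_I this, of t]
    obtain U where U: "t \<in> U" "open U" "\<forall>s\<in>U \<inter> UNIV. \<forall>x\<in>K. dist (h (s, x)) (h (t, x)) \<le> e / 2"
      by blast
    have "mdist ?F (\<lambda>x\<in>K. h (t, x)) (\<lambda>x\<in>K. h (s, x)) \<le> e / 2" if "s \<in> U" for s
      by (rule mdist_cfunspace_le) (use U(3) that \<open>0 < e\<close> in \<open>auto simp: dist_commute\<close>)
    then have "(\<lambda>x\<in>K. h (s, x)) \<in> F.mball (\<lambda>x\<in>K. h (t, x)) e" if "s \<in> U" for s
      using that in_F \<open>0 < e\<close> by (force simp del: mspace_cfunspace)
    with U(1,2) show ?thesis by blast
  qed
  then show ?thesis
    using in_F unfolding mtopology_of_def F.continuous_map_to_metric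
    by (auto simp del: mspace_cfunspace)
qed

section \<open>Weighted geometric means as random means\<close>

text \<open>The weight may be any real, so that it parametrizes a continuous curve on the whole line
  that can be composed with \<open>\<xi>\<close>; the values are known to be means only for weights
  in \<open>{0..1}\<close>.\<close>

definition geo_mean :: "real \<Rightarrow> real^2 \<Rightarrow> real" where
  "geo_mean t x = x $ 1 powr t * x $ 2 powr (1 - t)"

lemma cube_Icc: "cube {a..b} = cbox (\<chi> i. a) (\<chi> i. b)"
  by (auto simp: cube_def mem_box_cart)

lemma cube_Icc_pos: "0 < a \<Longrightarrow> x \<in> cube {a..b} \<Longrightarrow> 0 < x $ i"
  by (auto simp: cube_def intro: less_le_trans)

lemma cube_Icc_nonzero: "0 < a \<Longrightarrow> x \<in> cube {a..b} \<Longrightarrow> x $ i \<noteq> 0"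
  using cube_Icc_pos[of a x b i] by simp

text \<open>Continuous functions on the compact cube are bounded, so the boundedness condition of
  the function space disappears.\<close>

lemma mspace_contfun_Icc:
  "mspace (contfun {a..b}) = {f \<in> extensional (cube {a..b}). continuous_on (cube {a..b}) f}"
  unfolding contfun_def
  by (subst compactin_mspace_cfunspace) (auto simp: compactin_subtopology cube_Icc)

lemma space_borel_contfun: "space (borel_contfun I) = mspace (contfun I)"
  by (simp add: borel_contfun_def space_measure_of_conv)

text \<open>It suffices to check the generators, the open sets of the supremum metric, whose
  preimages under \<open>g\<close> are open.\<close>

lemma measurable_borel_contfun:
  fixes g :: "'a::topological_space \<Rightarrow> real^'p \<Rightarrow> real"
  assumes "continuous_map euclidean (mtopology_of (contfun I)) g"
  shows "g \<in> borel \<rightarrow>\<^sub>M borel_contfun I"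
  unfolding borel_contfun_def
proof (rule measurable_measure_of)
  show "{U. openin (mtopology_of (contfun I)) U} \<subseteq> Pow (mspace (contfun I))"
    using openin_subset by fastforce
  show "g \<in> space borel \<rightarrow> mspace (contfun I)"
    using continuous_map_funspace[OF assms] by simp
  fix U :: "(real^'p \<Rightarrow> real) set" assume "U \<in> {U. openin (mtopology_of (contfun I)) U}"
  then have "open {x. g x \<in> U}"
    using openin_continuous_map_preimage[OF assms] by simp
  then show "g -` U \<inter> space borel \<in> sets borel"
    by (simp add: vimage_def)
qed

lemma means_Icc_range:
  assumes "m \<in> means {a..b}" "x \<in> cube {a..b}"
  shows "m x \<in> {a..b}"
proof -
  have "a \<le> Min (range (\<lambda>i. x $ i))" "Max (range (\<lambda>i. x $ i)) \<le> b"
    using assms(2) by (auto simp: cube_def)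
  moreover have "Min (range (\<lambda>i. x $ i)) \<le> m x" "m x \<le> Max (range (\<lambda>i. x $ i))"
    using assms by (auto simp: means_def)
  ultimately show ?thesis
    unfolding atLeastAtMost_iff by linarith
qed

text \<open>Both exponents are nonnegative, so each factor is monotone in its base; when the two
  bases coincide, the product collapses to that common base.\<close>

lemma geo_mean_in_means:
  assumes "0 < a" "t \<in> {0..1}"
  shows "(\<lambda>x\<in>cube {a..b}. geo_mean t x) \<in> means {a..b}"
proof -
  have "continuous_on (cube {a..b}) (\<lambda>x. geo_mean t x)"
    unfolding geo_mean_def
    by (intro continuous_intros) (auto simp: cube_Icc_nonzero[OF \<open>0 < a\<close>])
  moreover have "min (x $ 1) (x $ 2) \<le> geo_mean t x \<and> geo_mean t x \<le> max (x $ 1) (x $ 2)"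
    if "x \<in> cube {a..b}" for x
  proof -
    have pos: "0 < x $ 1" "0 < x $ 2"
      using cube_Icc_pos[OF \<open>0 < a\<close> that] by auto
    have split: "y = y powr t * y powr (1 - t)" if "0 < y" for y :: real
      using that by (simp flip: powr_add)
    let ?l = "min (x $ 1) (x $ 2)" and ?u = "max (x $ 1) (x $ 2)"
    have "?l powr t * ?l powr (1 - t) \<le> geo_mean t x" "geo_mean t x \<le> ?u powr t * ?u powr (1 - t)"
      unfolding geo_mean_def by (intro mult_mono powr_mono2; use pos assms in auto)+
    then show ?thesis
      using split[of ?l] split[of ?u] pos by auto
  qed
  ultimately show ?thesis
    by (simp add: means_def mspace_contfun_Icc UNIV_2)
qed

lemma measurable_geo_mean_curve:
  assumes "0 < a"
  shows "(\<lambda>t. \<lambda>x\<in>cube {a..b}. geo_mean t x) \<in> borel \<rightarrow>\<^sub>M borel_contfun {a..b}"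
proof (rule measurable_borel_contfun)
  have "continuous_on (UNIV \<times> cube {a..b}) (\<lambda>(t, x). geo_mean t x)"
    unfolding geo_mean_def case_prod_beta
    by (intro continuous_intros) (auto simp: cube_Icc_nonzero[OF assms])
  from continuous_map_cfunspace[OF _ this]
  show "continuous_map euclidean (mtopology_of (contfun {a..b})) (\<lambda>t. \<lambda>x\<in>cube {a..b}. geo_mean t x)"
    by (simp add: contfun_def cube_Icc)
qed

lemma random_mean_geo_mean:
  fixes \<xi> :: "'a \<Rightarrow> real"
  assumes "prob_space P" "0 < a" "mstar \<in> means {a..b}"
    and [measurable]: "\<xi> \<in> borel_measurable P"
    and M: "\<And>\<omega>. \<omega> \<in> space P \<Longrightarrow>
      M \<omega> = (if \<xi> \<omega> \<in> {0..1} then \<lambda>x\<in>cube {a..b}. geo_mean (\<xi> \<omega>) x else mstar)"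
  shows "random_mean P {a..b} \<xi> M"
proof -
  interpret prob_space P by fact
  let ?K = "cube {a..b} :: (real^2) set"
  \<comment> \<open>Falling back on \<open>mstar\<close> keeps the values in \<open>{a..b}\<close>
    for every real \<open>t\<close> and makes \<open>?h\<close> agree with \<open>M\<close> at every
    \<omega>, not just almost surely.\<close>
  let ?h = "\<lambda>(x, t). if t \<in> {0..1} then geo_mean t x else mstar x"
  have mean: "M \<omega> \<in> means {a..b}" if "\<omega> \<in> space P" for \<omega>
    using M[OF that] geo_mean_in_means[OF \<open>0 < a\<close>] \<open>mstar \<in> means {a..b}\<close> by auto
  have mstar: "mstar \<in> mspace (contfun {a..b})"
    using \<open>mstar \<in> means {a..b}\<close> by (simp add: means_def)
  \<comment> \<open>As a map into the function space, this switches on a measurable event between a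
    continuous curve composed with \<open>\<xi>\<close> and a constant.\<close>
  have "(\<lambda>\<omega>. if \<xi> \<omega> \<in> {0..1} then \<lambda>x\<in>?K. geo_mean (\<xi> \<omega>) x else mstar) \<in> P \<rightarrow>\<^sub>M borel_contfun {a..b}"
    using measurable_compose[OF \<open>\<xi> \<in> borel_measurable P\<close> measurable_geo_mean_curve[OF \<open>0 < a\<close>]] mstar
    by (intro measurable_If measurable_const) (auto simp: space_borel_contfun)
  then have "M \<in> P \<rightarrow>\<^sub>M borel_contfun {a..b}"
    using M by (simp cong: measurable_cong)
  moreover have "?h \<in> (restrict_space borel ?K \<Otimes>\<^sub>M borel) \<rightarrow>\<^sub>M restrict_space borel {a..b}"
  proof (rule measurable_restrict_space2)
    have "?h (x, t) \<in> {a..b}" if "x \<in> ?K" for x t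
      using means_Icc_range[OF geo_mean_in_means[OF \<open>0 < a\<close>] that] means_Icc_range[OF \<open>mstar \<in> means {a..b}\<close> that] that
      by auto
    then show "?h \<in> space (restrict_space borel ?K \<Otimes>\<^sub>M borel) \<rightarrow> {a..b}"
      by (auto simp: space_pair_measure space_restrict_space)
    have [measurable]: "(\<lambda>x. x $ i) \<in> borel_measurable (restrict_space borel ?K)" for i
      by (intro borel_measurable_continuous_on_restrict continuous_intros)
    have [measurable]: "mstar \<in> borel_measurable (restrict_space borel ?K)"
      using mstar by (intro borel_measurable_continuous_on_restrict) (simp add: mspace_contfun_Icc)
    show "?h \<in> borel_measurable (restrict_space borel ?K \<Otimes>\<^sub>M borel)"
      unfolding geo_mean_def by measurable
  qed
  moreover have eq: "M \<omega> x = ?h (x, \<xi> \<omega>)" if "\<omega> \<in> space P" "x \<in> ?K" for \<omega> x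
    using M[OF that(1)] that(2) by simp
  moreover have "(\<lambda>x\<in>?K. ?h (x, \<xi> \<omega>)) \<in> mspace (contfun {a..b})" if "\<omega> \<in> space P" for \<omega>
  proof -
    have "M \<omega> \<in> mspace (contfun {a..b})"
      using mean[OF that] by (simp add: means_def)
    \<comment> \<open>Both sides are \<open>undefined\<close> off the cube, so agreement on the cube
      is equality of functions.\<close>
    moreover from this have "(\<lambda>x\<in>?K. ?h (x, \<xi> \<omega>)) = M \<omega>"
      using eq[OF that] by (auto simp: mspace_contfun_Icc extensional_def)
    ultimately show ?thesis by simp
  qed
  moreover have "measure P {\<omega> \<in> space P. \<forall>x\<in>?K. M \<omega> x = ?h (x, \<xi> \<omega>)} = 1"
  proof -
    have "{\<omega> \<in> space P. \<forall>x\<in>?K. M \<omega> x = ?h (x, \<xi> \<omega>)} = space P"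
      using eq by blast
    then show ?thesis
      by (simp only: prob_space)
  qed
  ultimately show ?thesis
    unfolding random_mean_def using mean by (intro conjI bexI[of _ ?h]) auto
qed

section \<open>The supremum of the ratio\<close>

lemma SUP_cube_powr_ratio:
  assumes "0 < a" "a \<le> b"
  shows "(SUP x\<in>cube {a..b} :: (real^2) set. (x $ 1 / x $ 2) powr d) = (b / a) powr \<bar>d\<bar>"
proof -
  let ?K = "cube {a..b} :: (real^2) set" and ?r = "\<lambda>x::real^2. (x $ 1 / x $ 2) powr d"
  show ?thesis
  proof (rule cSup_eq_maximum)
    \<comment> \<open>The maximizing corner makes the quotient largest for a nonnegative exponent
      and smallest for a negative one.\<close>
    define x :: "real^2" where "x = (if 0 \<le> d then vector [b, a] else vector [a, b])"
    have "x \<in> ?K"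
      using assms by (auto simp: x_def cube_def forall_2)
    moreover have "?r x = (b / a) powr \<bar>d\<bar>"
      using assms by (auto simp: x_def powr_minus powr_divide field_simps powr_minus_divide)
    ultimately show "(b / a) powr \<bar>d\<bar> \<in> ?r ` ?K"
      by (intro image_eqI[of _ _ x]) auto
  next
    fix y assume "y \<in> ?r ` ?K"
    then obtain x :: "real^2" where x: "x \<in> ?K" "y = ?r x" by blast
    then have mem: "a \<le> x $ 1" "x $ 1 \<le> b" "a \<le> x $ 2" "x $ 2 \<le> b"
      by (auto simp: cube_def)
    with assms have pos: "0 < x $ 1" "0 < x $ 2" by auto
    have le: "x $ 1 / x $ 2 \<le> b / a" "x $ 2 / x $ 1 \<le> b / a"
      using mem pos assms by (auto intro: frac_le)
    show "y \<le> (b / a) powr \<bar>d\<bar>"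
    proof (cases "0 \<le> d")
      case True
      with le(1) pos show ?thesis
        unfolding x(2) by (auto intro!: powr_mono2)
    next
      case False
      have "y = (x $ 2 / x $ 1) powr (- d)"
        using pos by (simp add: x(2) powr_minus powr_divide)
      with False le(2) pos show ?thesis
        by (auto intro!: powr_mono2)
    qed
  qed
qed

text \<open>Multiplying geometric means adds their exponents and the root averages them. Division by
  the mean of weight \<open>e\<close> leaves opposite exponents on the two coordinates, hence a
  power of \<open>x $ 1 / x $ 2\<close> alone.\<close>

lemma sup_ratio_geo_mean:
  assumes "0 < a" "a \<le> b" "1 \<le> n"
    and M: "\<And>j. j \<in> {1..n} \<Longrightarrow> M j \<omega> = (\<lambda>x\<in>cube {a..b}. geo_mean (r j) x)"
  shows "sup_ratio {a..b} M e n \<omega> = (b / a) powr \<bar>(\<Sum>j=1..n. r j) / real n - e\<bar>"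
proof -
  define s where "s = (\<Sum>j=1..n. r j)"
  have "(\<Prod>j=1..n. M j \<omega> x) powr (1 / real n) / (x $ 1 powr e * x $ 2 powr (1 - e))
      = (x $ 1 / x $ 2) powr (s / real n - e)" if x: "x \<in> cube {a..b}" for x
  proof -
    have pos: "0 < x $ 1" "0 < x $ 2"
      using cube_Icc_pos[OF \<open>0 < a\<close> x] by auto
    have "(\<Prod>j=1..n. M j \<omega> x) = (\<Prod>j=1..n. x $ 1 powr r j * x $ 2 powr (1 - r j))"
      using x M by (intro prod.cong) (auto simp: geo_mean_def)
    also have "\<dots> = x $ 1 powr s * x $ 2 powr (real n - s)"
      using pos by (simp add: prod.distrib s_def sum_subtractf flip: powr_sum)
    also have "\<dots> powr (1 / real n) = x $ 1 powr (s / real n) * x $ 2 powr (1 - s / real n)"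
      using pos \<open>1 \<le> n\<close> by (simp add: powr_mult powr_powr diff_divide_distrib)
    also have "\<dots> / (x $ 1 powr e * x $ 2 powr (1 - e))
        = x $ 1 powr (s / real n - e) * x $ 2 powr (- (s / real n - e))"
      using pos by (simp add: powr_diff powr_add powr_minus field_simps)
    also have "\<dots> = (x $ 1 / x $ 2) powr (s / real n - e)"
      using pos by (simp only: powr_minus powr_divide) (simp add: powr_divide divide_inverse)
    finally show ?thesis .
  qed
  then show ?thesis
    unfolding sup_ratio_def s_def[symmetric] using SUP_cube_powr_ratio[OF assms(1,2)] by simp
qed

lemma borel_measurable_sup_ratio:
  assumes "0 < a" "a \<le> b"
    and mean: "\<And>j \<omega>. 1 \<le> j \<Longrightarrow> \<omega> \<in> space P \<Longrightarrow> M j \<omega> \<in> means {a..b}"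
    and meas: "\<And>j x. 1 \<le> j \<Longrightarrow> x \<in> cube {a..b} \<Longrightarrow> (\<lambda>\<omega>. M j \<omega> x) \<in> borel_measurable P"
  shows "sup_ratio {a..b} M e n \<in> borel_measurable P"
proof -
  let ?K = "cube {a..b} :: (real^2) set"
  have pos: "0 < M j \<omega> x" if "1 \<le> j" "\<omega> \<in> space P" "x \<in> ?K" for j \<omega> x
    using means_Icc_range[OF mean[OF that(1,2)] that(3)] \<open>0 < a\<close> by auto
  have cont: "continuous_on ?K (M j \<omega>)" if "1 \<le> j" "\<omega> \<in> space P" for j \<omega>
    using mean[OF that] by (auto simp: means_def mspace_contfun_Icc)
  have "(\<lambda>\<omega>. sup_ratio {a..b} M e n \<omega>) \<in> borel_measurable P"
    unfolding sup_ratio_def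
  proof (rule borel_measurable_SUP_continuous)
    show "compact ?K" by (simp add: cube_Icc)
    have "(\<chi> i. a) \<in> ?K"
      using \<open>a \<le> b\<close> by (simp add: cube_def)
    then show "?K \<noteq> {}" by blast
  next
    fix \<omega> assume \<omega>: "\<omega> \<in> space P"
    have "0 < (\<Prod>j=1..n. M j \<omega> x)" if "x \<in> ?K" for x
      using \<omega> that by (intro prod_pos pos) auto
    moreover have "x $ i > 0" if "x \<in> ?K" for x i
      by (rule cube_Icc_pos[OF \<open>0 < a\<close> that])
    ultimately show "continuous_on ?K
        (\<lambda>x. (\<Prod>j=1..n. M j \<omega> x) powr (1 / real n) / (x $ 1 powr e * x $ 2 powr (1 - e)))"
      using \<omega> by (intro continuous_intros cont) (auto simp: less_imp_neq[symmetric] simp del: prod_zero_iff)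
  next
    fix x assume [simp]: "x \<in> ?K"
    have [measurable]: "(\<lambda>\<omega>. \<Prod>j=1..n. M j \<omega> x) \<in> borel_measurable P"
      by (intro borel_measurable_prod meas) auto
    show "(\<lambda>\<omega>. (\<Prod>j=1..n. M j \<omega> x) powr (1 / real n) / (x $ 1 powr e * x $ 2 powr (1 - e)))
        \<in> borel_measurable P"
      by measurable
  qed
  then show ?thesis by simp
qed

section \<open>The almost sure limit and the limit law\<close>

theorem theorem3p5:
  fixes P :: "'a measure"
    and I :: "real set"
    and \<xi> :: "nat \<Rightarrow> 'a \<Rightarrow> real"
    and M :: "nat \<Rightarrow> 'a \<Rightarrow> real^2 \<Rightarrow> real"
    and mstar :: "real^2 \<Rightarrow> real"
  assumes "prob_space P"
    and "is_interval I" and "compact I" and "\<exists>a\<in>I. \<exists>b\<in>I. a \<noteq> b" and "I \<subseteq> {0<..}"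
    and "prob_space.indep_vars P (\<lambda>_. borel) \<xi> {1..}"
    and "\<forall>n\<ge>1. distr P borel (\<xi> n) = distr P borel (\<xi> 1)"
    and "measure P {\<omega> \<in> space P. \<xi> 1 \<omega> \<in> {0..1}} = 1"
    and "mstar \<in> means I"
    and "\<forall>n\<ge>1. \<forall>\<omega>\<in>space P. M n \<omega> =
           (if \<xi> n \<omega> \<in> {0..1} then (\<lambda>x\<in>cube I. x $ 1 powr \<xi> n \<omega> * x $ 2 powr (1 - \<xi> n \<omega>)) else mstar)"
  shows "(\<forall>n\<ge>1. random_mean P I (\<xi> n) (M n)) \<and>
    measure P {\<omega> \<in> space P.
      (\<lambda>n. sup_ratio I M (prob_space.expectation P (\<xi> 1)) n \<omega>) \<longlonglongrightarrow> 1} = 1 \<and>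
    (\<forall>n\<ge>1. (\<lambda>\<omega>. sup_ratio I M (prob_space.expectation P (\<xi> 1)) n \<omega> powr sqrt (real n))
       \<in> borel_measurable P) \<and>
    weak_conv_m
      (\<lambda>n. distr P borel
         (\<lambda>\<omega>. sup_ratio I M (prob_space.expectation P (\<xi> 1)) n \<omega> powr sqrt (real n)))
      (distr (normal_distribution 0 (prob_space.variance P (\<xi> 1))) borel
         (\<lambda>z. ((GREATEST x. x \<in> I) / (LEAST x. x \<in> I)) powr \<bar>z\<bar>))"
proof -
  interpret P: prob_space P by fact
  obtain a b where I: "I = {a..b}"
    using connected_compact_interval_1[of I] \<open>is_interval I\<close> \<open>compact I\<close> is_interval_connected_1 by metis
  have "a < b"
    using assms(4) by (auto simp: I)
  moreover from this have "a \<in> I"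
    by (simp add: I)
  ultimately have ab: "0 < a" "a < b"
    using assms(5) by auto
  have extremes: "(GREATEST x. x \<in> I) = b" "(LEAST x. x \<in> I) = a"
    using ab by (auto simp: I intro!: Greatest_equality Least_equality)
  define e where "e = P.expectation (\<xi> 1)"
  \<comment> \<open>The limit theorems above count from 0, the given sequence from 1.\<close>
  define X where "X i = \<xi> (Suc i)" for i
  let ?g = "\<lambda>z. (b / a) powr \<bar>z\<bar>"
  have M: "M n \<omega> = (if \<xi> n \<omega> \<in> {0..1} then \<lambda>x\<in>cube {a..b}. geo_mean (\<xi> n \<omega>) x else mstar)"
    if "1 \<le> n" "\<omega> \<in> space P" for n \<omega>
    using assms(10) that by (simp add: I geo_mean_def)
  have \<xi>_meas: "\<xi> n \<in> borel_measurable P" if "1 \<le> n" for n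
    using assms(6) that by (auto simp: P.indep_vars_def2)
  have mstar: "mstar \<in> means {a..b}"
    using assms(9) by (simp add: I)

  have [measurable]: "X i \<in> borel_measurable P" for i
    by (simp add: X_def \<xi>_meas)
  have "range Suc = {1..}"
    by (auto simp: image_iff Suc_le_eq gr0_conv_Suc)
  then have indep: "P.indep_vars (\<lambda>_. borel) X UNIV"
    using P.indep_vars_reindex[of Suc UNIV "\<lambda>_. borel" \<xi>] assms(6) by (simp add: comp_def X_def[abs_def])
  have iid: "distr P borel (X n) = distr P borel (X 0)" for n
    using assms(7)[rule_format, of "Suc n"] by (simp add: X_def)
  have "{\<omega> \<in> space P. \<xi> 1 \<omega> \<in> {0..1}} \<in> sets P"
    using \<xi>_meas[of 1] by simp
  then have X0: "AE \<omega> in P. X 0 \<omega> \<in> {0..1}"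
    using assms(8) by (simp add: P.prob_eq_1 X_def)
  \<comment> \<open>Lying in \<open>{0..1}\<close> almost surely is a property of the law, so it
    passes from \<open>X 0\<close> to every \<open>X n\<close>; countably many null events then
    merge into one in \<open>good\<close>.\<close>
  have "(AE x in distr P borel (X n). x \<in> {0..1}) \<longleftrightarrow> (AE \<omega> in P. X n \<omega> \<in> {0..1})" for n
    by (rule AE_distr_iff) auto
  then have "AE \<omega> in P. X n \<omega> \<in> {0..1}" for n
    using X0 iid[of n] by metis
  then have good: "AE \<omega> in P. \<forall>n. X n \<omega> \<in> {0..1}"
    by (simp only: AE_all_countable) simp

  have ratio: "sup_ratio I M e n \<omega> = ?g ((\<Sum>i<n. X i \<omega>) / real n - e)"
    if "1 \<le> n" "\<omega> \<in> space P" "\<forall>i. X i \<omega> \<in> {0..1}" for n \<omega>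
  proof -
    have "M j \<omega> = (\<lambda>x\<in>cube {a..b}. geo_mean (\<xi> j \<omega>) x)" if j: "j \<in> {1..n}" for j
      using M[of j \<omega>] \<open>\<forall>i. X i \<omega> \<in> {0..1}\<close>[rule_format, of "j - 1"] j \<open>\<omega> \<in> space P\<close>
      by (simp add: X_def)
    then have "sup_ratio I M e n \<omega> = ?g ((\<Sum>j=1..n. \<xi> j \<omega>) / real n - e)"
      unfolding I using ab \<open>1 \<le> n\<close> by (intro sup_ratio_geo_mean) auto
    also have "(\<Sum>j=1..n. \<xi> j \<omega>) = (\<Sum>i<n. X i \<omega>)"
      by (simp add: X_def sum.atLeast1_atMost_eq)
    finally show ?thesis .
  qed

  have mean: "M n \<omega> \<in> means {a..b}" if "1 \<le> n" "\<omega> \<in> space P" for n \<omega>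
    using M[OF that] geo_mean_in_means[OF \<open>0 < a\<close>] mstar by auto
  have M_meas: "(\<lambda>\<omega>. M n \<omega> x) \<in> borel_measurable P" if "1 \<le> n" "x \<in> cube {a..b}" for n x
  proof -
    have [measurable]: "\<xi> n \<in> borel_measurable P"
      by (rule \<xi>_meas) fact
    have "(\<lambda>\<omega>. if \<xi> n \<omega> \<in> {0..1} then geo_mean (\<xi> n \<omega>) x else mstar x) \<in> borel_measurable P"
      unfolding geo_mean_def by measurable
    then show ?thesis
      by (rule measurable_cong[THEN iffD1, rotated]) (use M[OF \<open>1 \<le> n\<close>] that(2) in auto)
  qed
  have [measurable]: "sup_ratio I M e n \<in> borel_measurable P" for n
    unfolding I using ab mean M_meas by (intro borel_measurable_sup_ratio) auto

  have means: "random_mean P I (\<xi> n) (M n)" if "1 \<le> n" for n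
    unfolding I using P.prob_space_axioms ab mstar \<xi>_meas[OF that] M[OF that]
    by (intro random_mean_geo_mean) auto

  have "AE \<omega> in P. (\<lambda>n. (\<Sum>i<n. X i \<omega>) / real n) \<longlonglongrightarrow> e"
    using P.strong_law_of_large_numbers_bounded[OF indep iid X0] by (simp add: e_def X_def)
  with good AE_space[of P] have "AE \<omega> in P. (\<lambda>n. sup_ratio I M e n \<omega>) \<longlonglongrightarrow> 1"
  proof eventually_elim
    case (elim \<omega>)
    from elim(3) have "(\<lambda>n. ?g ((\<Sum>i<n. X i \<omega>) / real n - e)) \<longlonglongrightarrow> ?g (e - e)"
      using ab by (intro tendsto_intros) auto
    then have "(\<lambda>n. ?g ((\<Sum>i<n. X i \<omega>) / real n - e)) \<longlonglongrightarrow> 1"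
      using ab by simp
    then show ?case
      by (rule Lim_transform_eventually)
        (use ratio elim in \<open>auto simp: eventually_sequentially intro!: exI[of _ 1]\<close>)
  qed
  then have almost_sure: "measure P {\<omega> \<in> space P. (\<lambda>n. sup_ratio I M e n \<omega>) \<longlonglongrightarrow> 1} = 1"
    by (subst P.prob_eq_1) auto

  let ?T = "\<lambda>n \<omega>. (\<Sum>i<n. X i \<omega> - e) / sqrt (real n)"
  have g: "continuous_on UNIV ?g"
    using ab by (intro continuous_intros) auto
  have [measurable]: "?g \<in> borel_measurable borel"
    by (rule borel_measurable_continuous_onI[OF g])
  have scaled: "sup_ratio I M e n \<omega> powr sqrt (real n) = ?g (?T n \<omega>)"
    if "1 \<le> n" "\<omega> \<in> space P" "\<forall>i. X i \<omega> \<in> {0..1}" for n \<omega>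
  proof -
    \<comment> \<open>Since \<open>n\<close> is \<open>s * s\<close>, dividing the centred sum by
      \<open>n\<close> and multiplying by \<open>s\<close> divides it by \<open>s\<close>, the
      normalization of the central limit theorem.\<close>
    define s where "s = sqrt (real n)"
    have "0 < s" "real n = s * s"
      using \<open>1 \<le> n\<close> by (simp_all add: s_def)
    then have "((\<Sum>i<n. X i \<omega>) / real n - e) * s = ?T n \<omega>"
      by (simp add: sum_subtractf field_simps flip: s_def)
    then have "\<bar>(\<Sum>i<n. X i \<omega>) / real n - e\<bar> * sqrt (real n) = \<bar>?T n \<omega>\<bar>"
      using \<open>0 < s\<close> by (metis abs_mult abs_of_pos s_def)
    then show ?thesis
      using ratio[OF that] by (simp add: powr_powr)
  qed
  have distr: "distr (distr P borel (?T n)) borel ?g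
      = distr P borel (\<lambda>\<omega>. sup_ratio I M e n \<omega> powr sqrt (real n))" if "1 \<le> n" for n
  proof -
    \<comment> \<open>The identity \<open>scaled\<close> is available only on the good event, but
      almost sure equality is enough for equal laws.\<close>
    have "AE \<omega> in P. ?g (?T n \<omega>) = sup_ratio I M e n \<omega> powr sqrt (real n)"
      using good AE_space[of P] by eventually_elim (use scaled[OF that] in simp)
    then have "distr P borel (\<lambda>\<omega>. ?g (?T n \<omega>)) = distr P borel (\<lambda>\<omega>. sup_ratio I M e n \<omega> powr sqrt (real n))"
      by (intro distr_cong_AE) auto
    then show ?thesis
      by (simp add: distr_distr comp_def)
  qed
  have "integrable P (\<lambda>\<omega>. (X 0 \<omega>)\<^sup>2)"
    by (rule P.integrable_const_bound[where B = 1]) (use X0 in \<open>auto simp: power_le_one\<close>)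
  then have "weak_conv_m (\<lambda>n. distr P borel (?T n)) (normal_distribution 0 (P.variance (\<xi> 1)))"
    using P.central_limit_theorem_normal_distribution[OF indep iid] by (simp add: e_def X_def)
  then have "weak_conv_m (\<lambda>n. distr (distr P borel (?T n)) borel ?g)
      (distr (normal_distribution 0 (P.variance (\<xi> 1))) borel ?g)"
    by (intro weak_conv_m_distr_continuous[OF _ _ _ g] P.real_distribution_distr
        real_distribution_normal_distribution) auto
  then have "weak_conv_m (\<lambda>n. distr P borel (\<lambda>\<omega>. sup_ratio I M e n \<omega> powr sqrt (real n)))
      (distr (normal_distribution 0 (P.variance (\<xi> 1))) borel ?g)"
    by (rule weak_conv_m_eventually_cong) (auto simp: distr eventually_sequentially intro!: exI[of _ 1])
  with means almost_sure show ?thesis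
    unfolding extremes e_def[symmetric] by simp
qed

end
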